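(* Let $D_4=\langle a,b\mid a^4=b^2=1,\ ba=a^{-1}b\rangle=\{a^k,\,ba^l : 0\le k,l\le3\}$ be the dihedral group of order $8$, and define $c:D_4\times D_4\to\mu_4$ by $$c(a^l,a^k)=c(ba^l,a^k)=1,\qquad c(a^l,ba^k)=c(ba^l,ba^k)=e^{2\pi\sqrt{-1}\,l/4}\qquad(0\le k,l\le3).$$ Then $c$ is a $2$-cocycle on $D_4$ with values in $\mu_4$.
   Context: $\mu_4\subset\mathbb C^\times$ is the group of fourth roots of unity. A $2$-cocycle on a group $G$ with values in an abelian group $A$ (trivial action) is a function $c:G\times G\to A$ with $c(1,x)=c(x,1)=1$ and $c(x,y)c(xy,z)=c(x,yz)c(y,z)$ for all $x,y,z\in G$. *)

theory Defs
  imports Complex_Main "HOL-Algebra.Coset"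
begin

section \<open>Groups given by generators and relations\<close>

text \<open>A word over the generators of type \<open>'g\<close>; \<open>(x, True)\<close> stands for \<open>x\<close> and \<open>(x, False)\<close>
  for the formal inverse of \<open>x\<close>. A relation \<open>u = v\<close> is a pair \<open>(u, v)\<close> of words.\<close>

type_synonym 'g word = "('g \<times> bool) list"

inductive pres_eq :: "('g word \<times> 'g word) set \<Rightarrow> 'g word \<Rightarrow> 'g word \<Rightarrow> bool"
  for R :: "('g word \<times> 'g word) set" where
  relator: "(u, v) \<in> R \<Longrightarrow> pres_eq R u v"
| cancel: "pres_eq R [(x, e), (x, \<not> e)] []"
| cong: "pres_eq R u v \<Longrightarrow> pres_eq R u' v' \<Longrightarrow> pres_eq R (u @ u') (v @ v')"
| rfl: "pres_eq R u u"
| symm: "pres_eq R u v \<Longrightarrow> pres_eq R v u"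
| trans: "pres_eq R u v \<Longrightarrow> pres_eq R v w \<Longrightarrow> pres_eq R u w"

definition pres_class :: "('g word \<times> 'g word) set \<Rightarrow> 'g word \<Rightarrow> 'g word set" where
  "pres_class R u = {v. pres_eq R u v}"

text \<open>Since \<open>pres_eq R\<close> is a congruence, the union in the product is the single class of the
  concatenation of representatives (see \<open>presented_group_mult\<close>).\<close>

definition presented_group :: "('g word \<times> 'g word) set \<Rightarrow> 'g word set monoid" where
  "presented_group R =
    \<lparr>carrier = range (pres_class R),
     monoid.mult = (\<lambda>X Y. \<Union>x\<in>X. \<Union>y\<in>Y. pres_class R (x @ y)),
     one = pres_class R []\<rparr>"

lemma pres_class_eq_iff: "pres_class R u = pres_class R v \<longleftrightarrow> pres_eq R u v"
  unfolding pres_class_def by (auto intro: pres_eq.intros)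

lemma presented_group_mult:
  "pres_class R u \<otimes>\<^bsub>presented_group R\<^esub> pres_class R v = pres_class R (u @ v)"
proof -
  have "pres_class R (x @ y) = pres_class R (u @ v)"
    if "x \<in> pres_class R u" "y \<in> pres_class R v" for x y
    using that unfolding pres_class_eq_iff by (auto simp: pres_class_def intro: pres_eq.intros)
  moreover have "u \<in> pres_class R u" "v \<in> pres_class R v"
    by (auto simp: pres_class_def intro: pres_eq.rfl)
  ultimately have "(\<Union>x\<in>pres_class R u. \<Union>y\<in>pres_class R v. pres_class R (x @ y)) =
      pres_class R (u @ v)"
    by blast
  then show ?thesis by (simp add: presented_group_def)
qed

lemma presented_group_one: "\<one>\<^bsub>presented_group R\<^esub> = pres_class R []"
  by (simp add: presented_group_def)

lemma presented_group_carrier: "carrier (presented_group R) = range (pres_class R)"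
  by (simp add: presented_group_def)

lemma pres_eq_inverse: "pres_eq R (rev (map (\<lambda>(x, e). (x, \<not> e)) w) @ w) []"
proof (induction w)
  case Nil
  show ?case by (simp add: pres_eq.rfl)
next
  case (Cons p w)
  obtain x e where p: "p = (x, e)" by fastforce
  let ?i = "rev (map (\<lambda>(x, e). (x, \<not> e)) w)"
  have "pres_eq R [(x, \<not> e), (x, e)] []"
    using pres_eq.cancel[of R x "\<not> e"] by simp
  then have "pres_eq R ([(x, \<not> e), (x, e)] @ w) ([] @ w)"
    by (rule pres_eq.cong) (rule pres_eq.rfl)
  then have "pres_eq R (?i @ [(x, \<not> e), (x, e)] @ w) (?i @ [] @ w)"
    by (rule pres_eq.cong[OF pres_eq.rfl])
  then show ?case using Cons p by (auto intro: pres_eq.trans)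
qed

lemma group_presented_group: "group (presented_group R)"
proof (rule groupI)
  fix X assume "X \<in> carrier (presented_group R)"
  then obtain w where "X = pres_class R w" by (auto simp: presented_group_carrier)
  then have "pres_class R (rev (map (\<lambda>(x, e). (x, \<not> e)) w)) \<otimes>\<^bsub>presented_group R\<^esub> X
      = \<one>\<^bsub>presented_group R\<^esub>"
    by (simp add: presented_group_mult presented_group_one pres_class_eq_iff pres_eq_inverse)
  then show "\<exists>Y\<in>carrier (presented_group R). Y \<otimes>\<^bsub>presented_group R\<^esub> X = \<one>\<^bsub>presented_group R\<^esub>"
    by (auto simp: presented_group_carrier)
qed (auto simp: presented_group_carrier presented_group_mult presented_group_one)

section \<open>The dihedral group of order 8\<close>

datatype dihedral_gen = Gen_a | Gen_b

definition D4_relations :: "(dihedral_gen word \<times> dihedral_gen word) set" where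
  "D4_relations =
    {(replicate 4 (Gen_a, True), []),
     (replicate 2 (Gen_b, True), []),
     ([(Gen_b, True), (Gen_a, True)], [(Gen_a, False), (Gen_b, True)])}"

definition D4 :: "dihedral_gen word set monoid" where
  "D4 = presented_group D4_relations"

definition D4_a :: "dihedral_gen word set" where
  "D4_a = pres_class D4_relations [(Gen_a, True)]"

definition D4_b :: "dihedral_gen word set" where
  "D4_b = pres_class D4_relations [(Gen_b, True)]"

section \<open>Cocycles with values in an abelian group\<close>

definition mu4 :: "complex monoid" where
  "mu4 = \<lparr>carrier = {z. z ^ 4 = 1}, monoid.mult = (*), one = 1\<rparr>"

locale two_cocycle = G: group G + A: comm_group A
  for G :: "('g, 'm) monoid_scheme" (structure) and A :: "('h, 'n) monoid_scheme" (structure)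
    and c :: "'g \<Rightarrow> 'g \<Rightarrow> 'h" +
  assumes closed: "c \<in> carrier G \<rightarrow> carrier G \<rightarrow> carrier A"
    and one_left: "x \<in> carrier G \<Longrightarrow> c \<one>\<^bsub>G\<^esub> x = \<one>\<^bsub>A\<^esub>"
    and one_right: "x \<in> carrier G \<Longrightarrow> c x \<one>\<^bsub>G\<^esub> = \<one>\<^bsub>A\<^esub>"
    and cocycle: "\<lbrakk>x \<in> carrier G; y \<in> carrier G; z \<in> carrier G\<rbrakk> \<Longrightarrow>
      c x y \<otimes>\<^bsub>A\<^esub> c (x \<otimes>\<^bsub>G\<^esub> y) z = c x (y \<otimes>\<^bsub>G\<^esub> z) \<otimes>\<^bsub>A\<^esub> c y z"

section \<open>The elements of D4, and well-definedness of functions given on them\<close>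

text \<open>The pair \<open>(e, l)\<close> represents \<open>b^e a^l\<close>; words act on these pairs from the right.\<close>

fun D4_step :: "bool \<times> int \<Rightarrow> dihedral_gen \<times> bool \<Rightarrow> bool \<times> int" where
  "D4_step (e, l) (Gen_a, s) = (e, (if s then l + 1 else l - 1) mod 4)"
| "D4_step (e, l) (Gen_b, s) = (\<not> e, (- l) mod 4)"

definition D4_nf :: "dihedral_gen word \<Rightarrow> bool \<times> int" where
  "D4_nf w = foldl D4_step (False, 0) w"

lemma D4_foldl_range:
  "snd p \<in> {0..<4} \<Longrightarrow> snd (foldl D4_step p w) \<in> {0..<4}"
proof (induction w arbitrary: p)
  case (Cons q w)
  have "snd (D4_step p q) \<in> {0..<4}"
    by (cases "(p, q)" rule: D4_step.cases) auto
  then show ?case using Cons.IH by simp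
qed simp

lemma D4_foldl_cong:
  "pres_eq D4_relations u v \<Longrightarrow> snd p \<in> {0..<4} \<Longrightarrow> foldl D4_step p u = foldl D4_step p v"
proof (induction arbitrary: p rule: pres_eq.induct)
  case (relator u v)
  obtain e l where "p = (e, l)" "l \<in> {0..<4}" using relator by (cases p) auto
  moreover from this have "l = 0 \<or> l = 1 \<or> l = 2 \<or> l = 3" by auto
  ultimately show ?case using relator
    by (auto simp: D4_relations_def numeral_eq_Suc)
next
  case (cancel x s)
  obtain e l where "p = (e, l)" "l \<in> {0..<4}" using cancel by (cases p) auto
  moreover from this have "l = 0 \<or> l = 1 \<or> l = 2 \<or> l = 3" by auto
  ultimately show ?case by (cases x) auto
next
  case (cong u v u' v')
  then show ?case using D4_foldl_range by (metis foldl_append)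
qed auto

lemma D4_nf_cong: "pres_eq D4_relations u v \<Longrightarrow> D4_nf u = D4_nf v"
  unfolding D4_nf_def by (rule D4_foldl_cong) auto

lemma group_D4: "group D4"
  unfolding D4_def by (rule group_presented_group)

lemma D4_a_carrier: "D4_a \<in> carrier D4" and D4_b_carrier: "D4_b \<in> carrier D4"
  by (auto simp: D4_a_def D4_b_def D4_def presented_group_carrier)

lemma D4_relation_a: "D4_a [^]\<^bsub>D4\<^esub> (4::nat) = \<one>\<^bsub>D4\<^esub>"
  and D4_relation_b: "D4_b [^]\<^bsub>D4\<^esub> (2::nat) = \<one>\<^bsub>D4\<^esub>"
  and D4_relation_ba: "D4_b \<otimes>\<^bsub>D4\<^esub> D4_a = inv\<^bsub>D4\<^esub> D4_a \<otimes>\<^bsub>D4\<^esub> D4_b"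
proof -
  interpret group D4 by (rule group_D4)
  let ?cl = "pres_class D4_relations"
  have "?cl [(Gen_a, True), (Gen_a, True), (Gen_a, True), (Gen_a, True)] = ?cl []"
    "?cl [(Gen_b, True), (Gen_b, True)] = ?cl []"
    by (auto simp: pres_class_eq_iff D4_relations_def numeral_eq_Suc intro!: pres_eq.relator)
  then show "D4_a [^]\<^bsub>D4\<^esub> (4::nat) = \<one>\<^bsub>D4\<^esub>" "D4_b [^]\<^bsub>D4\<^esub> (2::nat) = \<one>\<^bsub>D4\<^esub>"
    unfolding numeral_eq_Suc nat_pow_Suc
    by (auto simp: numeral_eq_Suc nat_pow_Suc D4_a_def D4_b_def D4_def presented_group_mult
        presented_group_one)
  have "?cl [(Gen_a, False)] \<otimes>\<^bsub>D4\<^esub> D4_a = \<one>\<^bsub>D4\<^esub>"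
    using pres_eq.cancel[of D4_relations Gen_a False]
    by (auto simp: D4_a_def D4_def presented_group_mult presented_group_one pres_class_eq_iff)
  then have "inv\<^bsub>D4\<^esub> D4_a = ?cl [(Gen_a, False)]"
    by (intro inv_equality) (auto simp: D4_a_carrier, auto simp: D4_def presented_group_carrier)
  then show "D4_b \<otimes>\<^bsub>D4\<^esub> D4_a = inv\<^bsub>D4\<^esub> D4_a \<otimes>\<^bsub>D4\<^esub> D4_b"
    by (auto simp: D4_a_def D4_b_def D4_def presented_group_mult pres_class_eq_iff
        D4_relations_def intro!: pres_eq.relator)
qed

lemma D4_pow_a: "D4_a [^]\<^bsub>D4\<^esub> (k::nat) = pres_class D4_relations (replicate k (Gen_a, True))"
proof (induction k)
  case (Suc k)
  then show ?case
    by (simp add: D4_def D4_a_def presented_group_mult flip: replicate_append_same)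
qed (simp add: D4_def presented_group_one)

lemma D4_b_pow_a:
  "D4_b \<otimes>\<^bsub>D4\<^esub> D4_a [^]\<^bsub>D4\<^esub> (k::nat) =
    pres_class D4_relations ((Gen_b, True) # replicate k (Gen_a, True))"
  unfolding D4_pow_a by (simp add: D4_b_def D4_def presented_group_mult)

lemma D4_nf_a:
  "k \<le> 3 \<Longrightarrow> D4_nf (replicate k (Gen_a, True)) = (False, int k)"
  "k \<le> 3 \<Longrightarrow> D4_nf ((Gen_b, True) # replicate k (Gen_a, True)) = (True, int k)"
proof -
  assume "k \<le> 3"
  then have "k = 0 \<or> k = 1 \<or> k = 2 \<or> k = 3" by auto
  then show "D4_nf (replicate k (Gen_a, True)) = (False, int k)"
    "D4_nf ((Gen_b, True) # replicate k (Gen_a, True)) = (True, int k)"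
    by (auto simp: D4_nf_def numeral_eq_Suc)
qed

lemma D4_carrier:
  "carrier D4 = {D4_a [^]\<^bsub>D4\<^esub> k |k::nat. k \<le> 3} \<union> {D4_b \<otimes>\<^bsub>D4\<^esub> D4_a [^]\<^bsub>D4\<^esub> l |l::nat. l \<le> 3}"
  (is "_ = ?E")
proof
  interpret group D4 by (rule group_D4)
  note [simp] = D4_a_carrier D4_b_carrier
  show "?E \<subseteq> carrier D4" by auto
  have a4: "D4_a \<otimes>\<^bsub>D4\<^esub> D4_a \<otimes>\<^bsub>D4\<^esub> D4_a \<otimes>\<^bsub>D4\<^esub> D4_a = \<one>\<^bsub>D4\<^esub>"
    using D4_relation_a by (simp add: numeral_eq_Suc)
  have pow_mod: "D4_a [^]\<^bsub>D4\<^esub> n = D4_a [^]\<^bsub>D4\<^esub> (n mod 4)" for n :: nat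
  proof -
    have "D4_a [^]\<^bsub>D4\<^esub> n = D4_a [^]\<^bsub>D4\<^esub> (4 * (n div 4) + n mod 4)" by simp
    also have "\<dots> = D4_a [^]\<^bsub>D4\<^esub> (n mod 4)"
      using D4_relation_a by (simp only: nat_pow_mult[symmetric] D4_a_carrier
          nat_pow_pow[symmetric] nat_pow_one l_one nat_pow_closed)
    finally show ?thesis .
  qed
  have inv_a: "inv\<^bsub>D4\<^esub> D4_a = D4_a [^]\<^bsub>D4\<^esub> (3::nat)"
    by (rule inv_equality) (use a4 in \<open>auto simp: numeral_eq_Suc\<close>)
  have bb: "D4_b \<otimes>\<^bsub>D4\<^esub> D4_b = \<one>\<^bsub>D4\<^esub>"
    using D4_relation_b by (simp add: numeral_eq_Suc)
  have a_b: "D4_a \<otimes>\<^bsub>D4\<^esub> D4_b = D4_b \<otimes>\<^bsub>D4\<^esub> D4_a [^]\<^bsub>D4\<^esub> (3::nat)"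
  proof -
    have "D4_a \<otimes>\<^bsub>D4\<^esub> D4_b \<otimes>\<^bsub>D4\<^esub> D4_a = D4_b"
      using D4_relation_ba by (simp add: m_assoc inv_solve_left flip: m_assoc)
    then have "D4_a \<otimes>\<^bsub>D4\<^esub> D4_b = D4_b \<otimes>\<^bsub>D4\<^esub> inv\<^bsub>D4\<^esub> D4_a"
      by (intro inv_solve_right[THEN iffD2]) auto
    then show ?thesis using inv_a by simp
  qed
  have pow_b: "D4_a [^]\<^bsub>D4\<^esub> n \<otimes>\<^bsub>D4\<^esub> D4_b = D4_b \<otimes>\<^bsub>D4\<^esub> D4_a [^]\<^bsub>D4\<^esub> (3 * n)" for n :: nat
  proof (induction n)
    case (Suc n)
    have "D4_a [^]\<^bsub>D4\<^esub> Suc n \<otimes>\<^bsub>D4\<^esub> D4_b = D4_a [^]\<^bsub>D4\<^esub> n \<otimes>\<^bsub>D4\<^esub> (D4_a \<otimes>\<^bsub>D4\<^esub> D4_b)"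
      by (simp add: m_assoc)
    also have "\<dots> = (D4_a [^]\<^bsub>D4\<^esub> n \<otimes>\<^bsub>D4\<^esub> D4_b) \<otimes>\<^bsub>D4\<^esub> D4_a [^]\<^bsub>D4\<^esub> (3::nat)"
      unfolding a_b by (simp add: m_assoc)
    also have "\<dots> = D4_b \<otimes>\<^bsub>D4\<^esub> D4_a [^]\<^bsub>D4\<^esub> (3 * Suc n)"
      unfolding Suc by (simp add: m_assoc nat_pow_mult add.commute)
    finally show ?case .
  qed simp
  have bbx: "D4_b \<otimes>\<^bsub>D4\<^esub> (D4_b \<otimes>\<^bsub>D4\<^esub> D4_a [^]\<^bsub>D4\<^esub> n) = D4_a [^]\<^bsub>D4\<^esub> n" for n :: nat
    by (simp add: bb flip: m_assoc)
  have E1: "D4_a [^]\<^bsub>D4\<^esub> n \<in> ?E" and E2: "D4_b \<otimes>\<^bsub>D4\<^esub> D4_a [^]\<^bsub>D4\<^esub> n \<in> ?E" for n :: nat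
  proof -
    have "n mod 4 \<le> 3" by simp
    then show "D4_a [^]\<^bsub>D4\<^esub> n \<in> ?E" "D4_b \<otimes>\<^bsub>D4\<^esub> D4_a [^]\<^bsub>D4\<^esub> n \<in> ?E"
      unfolding pow_mod[of n] by blast+
  qed
  have mult_a: "x \<otimes>\<^bsub>D4\<^esub> D4_a [^]\<^bsub>D4\<^esub> n \<in> ?E" if "x \<in> ?E" for x and n :: nat
  proof -
    from that obtain k :: nat where "x = D4_a [^]\<^bsub>D4\<^esub> k \<or> x = D4_b \<otimes>\<^bsub>D4\<^esub> D4_a [^]\<^bsub>D4\<^esub> k" by blast
    then have "x \<otimes>\<^bsub>D4\<^esub> D4_a [^]\<^bsub>D4\<^esub> n = D4_a [^]\<^bsub>D4\<^esub> (k + n) \<or>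
        x \<otimes>\<^bsub>D4\<^esub> D4_a [^]\<^bsub>D4\<^esub> n = D4_b \<otimes>\<^bsub>D4\<^esub> D4_a [^]\<^bsub>D4\<^esub> (k + n)"
      by (auto simp: m_assoc nat_pow_mult)
    then show ?thesis by (elim disjE) (simp_all only: E1 E2)
  qed
  have mult_b: "x \<otimes>\<^bsub>D4\<^esub> D4_b \<in> ?E" if "x \<in> ?E" for x
  proof -
    from that obtain k :: nat where "x = D4_a [^]\<^bsub>D4\<^esub> k \<or> x = D4_b \<otimes>\<^bsub>D4\<^esub> D4_a [^]\<^bsub>D4\<^esub> k" by blast
    then have "x \<otimes>\<^bsub>D4\<^esub> D4_b = D4_b \<otimes>\<^bsub>D4\<^esub> D4_a [^]\<^bsub>D4\<^esub> (3 * k) \<or> x \<otimes>\<^bsub>D4\<^esub> D4_b = D4_a [^]\<^bsub>D4\<^esub> (3 * k)"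
      by (elim disjE) (simp_all add: m_assoc pow_b bbx)
    then show ?thesis by (elim disjE) (simp_all only: E1 E2)
  qed
  let ?cl = "pres_class D4_relations"
  have cl_carrier [simp]: "?cl w \<in> carrier D4" for w
    by (auto simp: D4_def presented_group_carrier)
  have cl_inv: "?cl [(x, False)] = inv\<^bsub>D4\<^esub> (?cl [(x, True)])" for x
    using pres_eq.cancel[of D4_relations x False]
    by (intro inv_equality[symmetric])
      (auto simp: D4_def presented_group_mult presented_group_one pres_class_eq_iff
        presented_group_carrier)
  have "?cl w \<in> ?E" for w
  proof (induction w rule: rev_induct)
    case Nil
    have "?cl [] = D4_a [^]\<^bsub>D4\<^esub> (0::nat)"
      by (simp add: D4_def presented_group_one)
    then show ?case by (simp only: E1)
  next
    case (snoc p w)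
    obtain x e where p: "p = (x, e)" by fastforce
    have split: "?cl (w @ [p]) = ?cl w \<otimes>\<^bsub>D4\<^esub> ?cl [p]" by (simp add: D4_def presented_group_mult)
    have inv_b: "inv\<^bsub>D4\<^esub> D4_b = D4_b" using bb by (intro inv_equality) auto
    have "?cl [p] = D4_a [^]\<^bsub>D4\<^esub> (1::nat) \<or> ?cl [p] = D4_a [^]\<^bsub>D4\<^esub> (3::nat) \<or> ?cl [p] = D4_b"
    proof (cases x; cases e)
      assume "x = Gen_a" "e"
      then show ?thesis using p by (simp flip: D4_a_def)
    next
      assume "x = Gen_a" "\<not> e"
      then show ?thesis using p cl_inv[of x] inv_a by (simp flip: D4_a_def)
    next
      assume "x = Gen_b" "e"
      then show ?thesis using p by (simp flip: D4_b_def)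
    next
      assume "x = Gen_b" "\<not> e"
      then show ?thesis using p cl_inv[of x] inv_b by (simp flip: D4_b_def)
    qed
    then show ?case unfolding split
      by (elim disjE) (simp_all only: mult_a[OF snoc] mult_b[OF snoc])
  qed
  then show "carrier D4 \<subseteq> ?E" by (auto simp: D4_def presented_group_carrier)
qed

text \<open>\<open>D4_coord x\<close> is the pair \<open>(e, l)\<close> with \<open>x = b^e a^l\<close> and \<open>l < 4\<close>.\<close>

definition D4_coord :: "dihedral_gen word set \<Rightarrow> bool \<times> nat" where
  "D4_coord X = map_prod id nat (D4_nf (SOME w. w \<in> X))"

lemma D4_coord:
  assumes "k \<le> 3"
  shows "D4_coord (D4_a [^]\<^bsub>D4\<^esub> (k::nat)) = (False, k)"
    and "D4_coord (D4_b \<otimes>\<^bsub>D4\<^esub> D4_a [^]\<^bsub>D4\<^esub> (k::nat)) = (True, k)"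
proof -
  have "D4_nf (SOME w. w \<in> pres_class D4_relations u) = D4_nf u" for u
  proof -
    have "\<exists>w. w \<in> pres_class D4_relations u"
      by (auto simp: pres_class_def intro: pres_eq.rfl)
    then have "(SOME w. w \<in> pres_class D4_relations u) \<in> pres_class D4_relations u"
      by (rule someI_ex)
    then show ?thesis unfolding pres_class_def using D4_nf_cong by auto
  qed
  then show "D4_coord (D4_a [^]\<^bsub>D4\<^esub> k) = (False, k)"
    "D4_coord (D4_b \<otimes>\<^bsub>D4\<^esub> D4_a [^]\<^bsub>D4\<^esub> k) = (True, k)"
    unfolding D4_coord_def D4_b_pow_a unfolding D4_pow_a using D4_nf_a[OF assms] by simp_all
qed

lemma order_D4: "order D4 = 8"
proof -
  have "bij_betw D4_coord (carrier D4) (UNIV \<times> {..3})"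
  proof (rule bij_betw_imageI)
    show "inj_on D4_coord (carrier D4)"
      unfolding D4_carrier by (auto intro!: inj_onI simp: D4_coord)
    have "(e, k) \<in> D4_coord ` carrier D4" if "k \<le> 3" for e k
    proof (cases e)
      case True
      then show ?thesis using D4_coord(2)[OF that] that unfolding D4_carrier by force
    next
      case False
      then show ?thesis using D4_coord(1)[OF that] that unfolding D4_carrier by force
    qed
    then show "D4_coord ` carrier D4 = UNIV \<times> {..3}"
      by (auto simp: D4_carrier D4_coord)
  qed
  then have "card (carrier D4) = card ((UNIV :: bool set) \<times> {..3::nat})"
    by (rule bij_betw_same_card)
  then show ?thesis by (simp add: order_def card_cartesian_product)
qed

text \<open>A function on pairs may be prescribed freely on the listed elements, so the four equations
  below do define a function.\<close>

lemma D4_cocycle_exists: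
  "\<exists>c :: dihedral_gen word set \<Rightarrow> dihedral_gen word set \<Rightarrow> complex.
    \<forall>k\<le>3::nat. \<forall>l\<le>3::nat.
    c (D4_a [^]\<^bsub>D4\<^esub> l) (D4_a [^]\<^bsub>D4\<^esub> k) = 1 \<and>
    c (D4_b \<otimes>\<^bsub>D4\<^esub> D4_a [^]\<^bsub>D4\<^esub> l) (D4_a [^]\<^bsub>D4\<^esub> k) = 1 \<and>
    c (D4_a [^]\<^bsub>D4\<^esub> l) (D4_b \<otimes>\<^bsub>D4\<^esub> D4_a [^]\<^bsub>D4\<^esub> k) = exp (2 * of_real pi * \<i> * of_nat l / 4) \<and>
    c (D4_b \<otimes>\<^bsub>D4\<^esub> D4_a [^]\<^bsub>D4\<^esub> l) (D4_b \<otimes>\<^bsub>D4\<^esub> D4_a [^]\<^bsub>D4\<^esub> k) = exp (2 * of_real pi * \<i> * of_nat l / 4)"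
  by (rule exI[of _ "\<lambda>x y. if fst (D4_coord y)
        then exp (2 * of_real pi * \<i> * of_nat (snd (D4_coord x)) / 4) else 1"])
    (auto simp: D4_coord)

end

theory Submission
  imports Defs
begin

text \<open>Let \<open>\<chi>(b^e a^l) = \<i>^l\<close>, and let \<open>\<epsilon>\<close> be the homomorphism onto \<open>\<int>/2\<close> with
  \<open>\<epsilon>(b^e a^l) = e\<close>, so that \<open>c x y = \<chi>(x)^\<epsilon>(y)\<close>. As \<open>a^l b = b a^(-l)\<close>, we have
  \<open>\<chi>(xy) = \<chi>(x)\<chi>(y)\<close> if \<open>\<epsilon>(y) = 0\<close> and \<open>\<chi>(xy) = \<chi>(y)/\<chi>(x)\<close> if \<open>\<epsilon>(y) = 1\<close>.
  Both sides of the cocycle identity at \<open>(x, y, z)\<close> are therefore \<open>\<chi>(x)^\<epsilon>(y)\<close> if \<open>\<epsilon>(z) = 0\<close>;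
  if \<open>\<epsilon>(z) = 1\<close> they are \<open>\<chi>(x)\<chi>(y)\<close> for \<open>\<epsilon>(y) = 0\<close> and \<open>\<chi>(y)\<close> for \<open>\<epsilon>(y) = 1\<close>.\<close>

lemma comm_group_mu4: "comm_group mu4"
proof (rule comm_groupI)
  fix x assume "x \<in> carrier mu4"
  then have "x ^ 4 = 1" by (simp add: mu4_def)
  then have "inverse x ^ 4 = 1" "inverse x * x = 1"
    by (auto simp: power_inverse intro!: left_inverse)
  then show "\<exists>y\<in>carrier mu4. y \<otimes>\<^bsub>mu4\<^esub> x = \<one>\<^bsub>mu4\<^esub>"
    by (auto simp: mu4_def)
qed (auto simp: mu4_def power_mult_distrib)

lemma exp_quarter_turns: "exp (2 * of_real pi * \<i> * of_nat l / 4) = \<i> ^ l"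
proof -
  have "exp (2 * of_real pi * \<i> * of_nat l / 4) = exp (of_nat l * (of_real (pi / 2) * \<i>))"
    by (simp add: field_simps)
  also have "\<dots> = exp (of_real (pi / 2) * \<i>) ^ l"
    by (rule exp_of_nat_mult)
  also have "exp (of_real (pi / 2) * \<i>) = \<i>"
    by (simp add: exp_eq_polar cis_pi_half mult.commute flip: cis_conv_exp)
  finally show ?thesis .
qed

lemma i_power_mod_4: "\<i> ^ (n mod 4) = \<i> ^ n"
proof -
  have "\<i> ^ n = \<i> ^ (4 * (n div 4) + n mod 4)" by simp
  also have "\<dots> = \<i> ^ (n mod 4)" by (simp only: power_add power_mult) simp
  finally show ?thesis by simp
qed

text \<open>The exponent is unbounded, so an element has many names, but products can be written
  without reducing modulo 4.\<close>

definition D4_elem :: "bool \<Rightarrow> nat \<Rightarrow> dihedral_gen word set" where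
  "D4_elem e n = (if e then D4_b \<otimes>\<^bsub>D4\<^esub> D4_a [^]\<^bsub>D4\<^esub> n else D4_a [^]\<^bsub>D4\<^esub> n)"

lemma D4_elem_cases:
  assumes "x \<in> carrier D4"
  obtains e n where "x = D4_elem e n"
proof -
  from assms consider k :: nat where "x = D4_a [^]\<^bsub>D4\<^esub> k"
    | k :: nat where "x = D4_b \<otimes>\<^bsub>D4\<^esub> D4_a [^]\<^bsub>D4\<^esub> k"
    unfolding D4_carrier by blast
  then show thesis
    by cases (use that[of False] that[of True] in \<open>auto simp: D4_elem_def\<close>)
qed

lemma D4_one_eq: "\<one>\<^bsub>D4\<^esub> = D4_elem False 0"
  by (simp add: D4_elem_def)

lemma D4_elem_mod_4: "D4_elem e (n mod 4) = D4_elem e n"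
proof -
  interpret group D4 by (rule group_D4)
  note [simp] = D4_a_carrier
  have "D4_a [^]\<^bsub>D4\<^esub> n = (D4_a [^]\<^bsub>D4\<^esub> (4::nat)) [^]\<^bsub>D4\<^esub> (n div 4) \<otimes>\<^bsub>D4\<^esub> D4_a [^]\<^bsub>D4\<^esub> (n mod 4)"
    by (simp add: nat_pow_mult nat_pow_pow)
  then show ?thesis by (simp add: D4_elem_def D4_relation_a)
qed

text \<open>The exponent \<open>3 * m\<close> stands for \<open>-m\<close>, keeping exponents in \<open>nat\<close>.\<close>

lemma D4_elem_mult:
  "D4_elem e m \<otimes>\<^bsub>D4\<^esub> D4_elem f n = D4_elem (e \<noteq> f) ((if f then 3 * m else m) + n)"
proof -
  interpret group D4 by (rule group_D4)
  note [simp] = D4_a_carrier D4_b_carrier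
  have bb: "D4_b \<otimes>\<^bsub>D4\<^esub> D4_b = \<one>\<^bsub>D4\<^esub>"
    using D4_relation_b by (simp add: numeral_eq_Suc)
  have inv_a: "inv\<^bsub>D4\<^esub> D4_a = D4_a [^]\<^bsub>D4\<^esub> (3::nat)"
    by (rule inv_equality) (use D4_relation_a in \<open>simp_all add: numeral_eq_Suc\<close>)
  \<comment> \<open>This is \<open>ba = a^(-1) b\<close> multiplied by \<open>a\<close> on the left;
    cancelling the right factor \<open>a\<close> then moves \<open>b\<close> to the front.\<close>
  have "D4_a \<otimes>\<^bsub>D4\<^esub> D4_b \<otimes>\<^bsub>D4\<^esub> D4_a = D4_b"
    using D4_relation_ba by (simp add: m_assoc inv_solve_left flip: m_assoc)
  then have "D4_a \<otimes>\<^bsub>D4\<^esub> D4_b = D4_b \<otimes>\<^bsub>D4\<^esub> inv\<^bsub>D4\<^esub> D4_a"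
    by (intro inv_solve_right[THEN iffD2]) auto
  then have ab: "D4_a \<otimes>\<^bsub>D4\<^esub> D4_b = D4_b \<otimes>\<^bsub>D4\<^esub> D4_a [^]\<^bsub>D4\<^esub> (3::nat)"
    by (simp only: inv_a)
  have pow_ab: "D4_a [^]\<^bsub>D4\<^esub> k \<otimes>\<^bsub>D4\<^esub> D4_b = D4_b \<otimes>\<^bsub>D4\<^esub> D4_a [^]\<^bsub>D4\<^esub> (3 * k)" for k :: nat
  proof (induction k)
    case (Suc k)
    have "D4_a [^]\<^bsub>D4\<^esub> Suc k \<otimes>\<^bsub>D4\<^esub> D4_b
        = (D4_a [^]\<^bsub>D4\<^esub> k \<otimes>\<^bsub>D4\<^esub> D4_b) \<otimes>\<^bsub>D4\<^esub> D4_a [^]\<^bsub>D4\<^esub> (3::nat)"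
      by (simp add: m_assoc ab)
    also have "\<dots> = D4_b \<otimes>\<^bsub>D4\<^esub> D4_a [^]\<^bsub>D4\<^esub> (3 * Suc k)"
      unfolding Suc by (simp add: m_assoc nat_pow_mult add.commute)
    finally show ?case .
  qed simp
  have pow_b_pow: "D4_a [^]\<^bsub>D4\<^esub> m \<otimes>\<^bsub>D4\<^esub> (D4_b \<otimes>\<^bsub>D4\<^esub> D4_a [^]\<^bsub>D4\<^esub> n)
      = D4_b \<otimes>\<^bsub>D4\<^esub> D4_a [^]\<^bsub>D4\<^esub> (3 * m + n)"
    by (simp add: pow_ab nat_pow_mult m_assoc flip: m_assoc[of _ D4_b])
  have b_b_pow: "D4_b \<otimes>\<^bsub>D4\<^esub> (D4_b \<otimes>\<^bsub>D4\<^esub> D4_a [^]\<^bsub>D4\<^esub> k) = D4_a [^]\<^bsub>D4\<^esub> k" for k :: nat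
    by (simp add: bb flip: m_assoc)
  show ?thesis
    by (cases e; cases f) (simp_all add: D4_elem_def m_assoc nat_pow_mult pow_b_pow b_b_pow)
qed

theorem lemma5p19:
  fixes c :: "dihedral_gen word set \<Rightarrow> dihedral_gen word set \<Rightarrow> complex"
  assumes "\<And>(k::nat) (l::nat). k \<le> 3 \<Longrightarrow> l \<le> 3 \<Longrightarrow>
      c (D4_a [^]\<^bsub>D4\<^esub> l) (D4_a [^]\<^bsub>D4\<^esub> k) = 1"
    and "\<And>(k::nat) (l::nat). k \<le> 3 \<Longrightarrow> l \<le> 3 \<Longrightarrow>
      c (D4_b \<otimes>\<^bsub>D4\<^esub> D4_a [^]\<^bsub>D4\<^esub> l) (D4_a [^]\<^bsub>D4\<^esub> k) = 1"
    and "\<And>(k::nat) (l::nat). k \<le> 3 \<Longrightarrow> l \<le> 3 \<Longrightarrow>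
      c (D4_a [^]\<^bsub>D4\<^esub> l) (D4_b \<otimes>\<^bsub>D4\<^esub> D4_a [^]\<^bsub>D4\<^esub> k) = exp (2 * of_real pi * \<i> * of_nat l / 4)"
    and "\<And>(k::nat) (l::nat). k \<le> 3 \<Longrightarrow> l \<le> 3 \<Longrightarrow>
      c (D4_b \<otimes>\<^bsub>D4\<^esub> D4_a [^]\<^bsub>D4\<^esub> l) (D4_b \<otimes>\<^bsub>D4\<^esub> D4_a [^]\<^bsub>D4\<^esub> k) =
        exp (2 * of_real pi * \<i> * of_nat l / 4)"
  shows "two_cocycle D4 mu4 c"
proof -
  \<comment> \<open>The hypotheses cover exponents up to 3; they extend to all exponents because
    \<open>a\<close> and \<open>\<i>\<close> both have fourth power 1.\<close>
  have c_elem: "c (D4_elem e m) (D4_elem f n) = (if f then \<i> ^ m else 1)" for e f m n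
  proof -
    have "m mod 4 \<le> 3" "n mod 4 \<le> 3" by simp_all
    then have "c (D4_elem e (m mod 4)) (D4_elem f (n mod 4)) = (if f then \<i> ^ (m mod 4) else 1)"
      unfolding D4_elem_def using assms exp_quarter_turns by (cases e; cases f) simp_all
    then show ?thesis by (simp only: D4_elem_mod_4 i_power_mod_4)
  qed
  have i4: "\<i> ^ (m * 4) = 1" for m
    using i_power_mod_4[of "m * 4"] by simp
  interpret G: group D4 by (rule group_D4)
  interpret A: comm_group mu4 by (rule comm_group_mu4)
  show ?thesis
  proof unfold_locales
    show "c \<in> carrier D4 \<rightarrow> carrier D4 \<rightarrow> carrier mu4"
      by (auto elim!: D4_elem_cases simp: c_elem mu4_def i4 simp flip: power_mult)
  next
    fix x assume "x \<in> carrier D4"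
    then show "c \<one>\<^bsub>D4\<^esub> x = \<one>\<^bsub>mu4\<^esub>" "c x \<one>\<^bsub>D4\<^esub> = \<one>\<^bsub>mu4\<^esub>"
      by (auto elim!: D4_elem_cases simp: D4_one_eq c_elem mu4_def)
  next
    fix x y z assume "x \<in> carrier D4" "y \<in> carrier D4" "z \<in> carrier D4"
    then obtain e l f m g n
      where xyz: "x = D4_elem e l" "y = D4_elem f m" "z = D4_elem g n"
      by (metis D4_elem_cases)
    \<comment> \<open>Needed when \<open>f\<close> and \<open>g\<close> both hold: \<open>y\<close>
      and \<open>z\<close> contain \<open>b\<close>, so \<open>yz\<close> is a power of
      \<open>a\<close> and \<open>c x (yz) = 1\<close>. The factor \<open>\<i> ^ (4 * l)\<close> is
      1. The other three cases follow from \<open>power_add\<close> alone.\<close>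
    have "\<i> ^ l * \<i> ^ (3 * l + m) = \<i> ^ m"
      using i4[of l] by (simp add: mult.commute flip: power_add add.assoc mult_Suc_right)
        (simp add: power_add)
    then show "c x y \<otimes>\<^bsub>mu4\<^esub> c (x \<otimes>\<^bsub>D4\<^esub> y) z = c x (y \<otimes>\<^bsub>D4\<^esub> z) \<otimes>\<^bsub>mu4\<^esub> c y z"
      by (cases f; cases g) (simp_all add: xyz D4_elem_mult c_elem mu4_def power_add)
  qed
qed

end
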